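(* Let $h \geq 2$. Let $X$ be a countably infinite set, and let $\mathcal{A}^* = (\mathcal{A}_1,\ldots,\mathcal{A}_h)$ be an $h$-tuple of sets of finite subsets of $X$. For every subset $S$ of $X$, let $g_{\mathcal{A}^*}(S)$ be the number of $h$-tuples $(A_1,\ldots,A_h) \in \mathcal{A}_1 \times \cdots \times \mathcal{A}_h$ such that $A_i \cap A_j = \emptyset$ for $1 \leq i < j \leq h$ and $S = \bigcup_{i=1}^h A_i$. Let $W$ be an infinite set of positive integers such that for every $n \in W$, one has $g_{\mathcal{A}^*}(S) \geq 2$ for all but finitely many sets $S \in [X]^n$. Then for every integer $n$ there is a finite subset $S$ of $X$ with $g_{\mathcal{A}^*}(S) \geq n$.
   Context: For a set $X$ and a nonnegative integer $k$, $[X]^k$ denotes the set of all subsets of $X$ of cardinality $k$. *)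

theory Defs
  imports "HOL-Library.Ramsey" "HOL-Library.FuncSet" "HOL-Library.Disjoint_Sets"
    "HOL-Library.Countable_Set"
begin

text \<open>
  An \<open>h\<close>-tuple is a function on the index set \<open>{1..h}\<close>; \<open>Pi\<^sub>E\<close> fixes its value outside
  that set, so that distinct functions are distinct tuples.
\<close>

definition disjoint_reps :: "nat \<Rightarrow> (nat \<Rightarrow> 'a set set) \<Rightarrow> 'a set \<Rightarrow> (nat \<Rightarrow> 'a set) set" where
  "disjoint_reps h \<A> S =
     {A \<in> Pi\<^sub>E {1..h} \<A>. disjoint_family_on A {1..h} \<and> S = (\<Union>i\<in>{1..h}. A i)}"

definition rep_count :: "nat \<Rightarrow> (nat \<Rightarrow> 'a set set) \<Rightarrow> 'a set \<Rightarrow> nat" where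
  "rep_count h \<A> S = card (disjoint_reps h \<A> S)"

text \<open>
  If the families consist of finite sets, every \<open>S\<close> has only finitely many representations, so
  the convention that an infinite set has cardinality 0 never takes effect in \<^const>\<open>rep_count\<close>.
\<close>

lemma finite_disjoint_reps:
  assumes "\<And>i. i \<in> {1..h} \<Longrightarrow> \<A> i \<subseteq> Fpow X"
  shows "finite (disjoint_reps h \<A> S)"
proof (cases "finite S")
  case True
  have "disjoint_reps h \<A> S \<subseteq> Pi\<^sub>E {1..h} (\<lambda>_. Pow S)"
    unfolding disjoint_reps_def by (fastforce simp: PiE_iff)
  then show ?thesis
    by (rule finite_subset) (use True in \<open>auto intro!: finite_PiE\<close>)
next
  case False
  have "finite (\<Union>i\<in>{1..h}. A i)" if "A \<in> Pi\<^sub>E {1..h} \<A>" for A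
    using that assms by (fastforce simp: PiE_iff Fpow_def)
  then have "disjoint_reps h \<A> S = {}"
    using False unfolding disjoint_reps_def by blast
  then show ?thesis by simp
qed

end

theory Submission
  imports Defs "HOL-Combinatorics.Transposition"
begin

text \<open>
  By Ramsey's theorem, for any two large \<open>n < m\<close> in \<open>W\<close> there is an infinite \<open>Y \<subseteq> X\<close>, avoiding
  the exceptional sets of sizes \<open>n\<close> and \<open>m\<close>, on which membership in each \<open>\<A> i\<close> depends only on the
  size of a set of at most \<open>m\<close> elements. A representation \<open>A\<close> of a set \<open>S \<subseteq> Y\<close> with
  \<open>{} \<noteq> A p \<noteq> S\<close> then yields \<open>card (A p) * card (S - A p) \<ge> card S - 1\<close> further ones by
  swapping an element of \<open>A p\<close> with one of \<open>S - A p\<close>. So if the counts are bounded, every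
  representation of a set of size \<open>k \<in> {n, m}\<close> has the form \<open>S, {}, \<dots>, {}\<close> up to order, and since there
  are two of them, \<open>{}\<close> lies in every family and the \<open>k\<close>-subsets of \<open>Y\<close> lie in two of the
  families. Placing an \<open>n\<close>-set and an \<open>m\<close>-set in different families represents a set
  of size \<open>n + m\<close> with two nonempty parts, which has many representations after all.
\<close>

definition homogeneous_on :: "'a set set \<Rightarrow> 'a set \<Rightarrow> nat \<Rightarrow> bool" where
  "homogeneous_on \<B> Y k \<longleftrightarrow> [Y]\<^bsup>k\<^esup> \<subseteq> \<B> \<or> [Y]\<^bsup>k\<^esup> \<inter> \<B> = {}"

lemma homogeneous_on_subset:
  "homogeneous_on \<B> Y k \<Longrightarrow> Z \<subseteq> Y \<Longrightarrow> homogeneous_on \<B> Z k"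
  using nsets_mono[of Z Y k] unfolding homogeneous_on_def by blast

lemma homogeneous_onD:
  assumes "homogeneous_on \<B> Y k" "T \<in> [Y]\<^bsup>k\<^esup>" "T \<in> \<B>" "T' \<in> [Y]\<^bsup>k\<^esup>"
  shows "T' \<in> \<B>"
  using assms unfolding homogeneous_on_def by blast

lemma infinite_homogeneous_subset:
  assumes "infinite Z"
  obtains Y where "Y \<subseteq> Z" "infinite Y" "homogeneous_on \<B> Y k"
proof -
  define f :: "'a set \<Rightarrow> nat" where "f T = (if T \<in> \<B> then 1 else 0)" for T
  have "\<forall>T. T \<subseteq> Z \<and> finite T \<and> card T = k \<longrightarrow> f T < 2"
    by (simp add: f_def)
  from Ramsey[OF assms this] obtain Y t where "Y \<subseteq> Z" "infinite Y"
    and mono: "\<forall>T. T \<subseteq> Y \<and> finite T \<and> card T = k \<longrightarrow> f T = t"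
    by blast
  moreover have "homogeneous_on \<B> Y k"
    using mono unfolding homogeneous_on_def nsets_def f_def
    by (cases "t = 1") (auto split: if_splits)
  ultimately show ?thesis using that by blast
qed

text \<open>Ramsey's theorem is applied once per pair, each time inside the set found before;
  homogeneity passes to subsets, so nothing gained earlier is lost.\<close>

lemma infinite_simultaneously_homogeneous_subset:
  assumes "finite I" "infinite Z"
  obtains Y where "Y \<subseteq> Z" "infinite Y" "\<And>\<B> k. (\<B>, k) \<in> I \<Longrightarrow> homogeneous_on \<B> Y k"
proof -
  have "\<exists>Y\<subseteq>Z. infinite Y \<and> (\<forall>(\<B>, k)\<in>I. homogeneous_on \<B> Y k)"
    using assms(1)
  proof induction
    case empty
    then show ?case using assms(2) by auto
  next
    case (insert c I)
    obtain \<B> k where c: "c = (\<B>, k)" by fastforce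
    from insert.IH obtain Y where Y: "Y \<subseteq> Z" "infinite Y"
      "\<forall>(\<B>, k)\<in>I. homogeneous_on \<B> Y k" by blast
    obtain Y' where "Y' \<subseteq> Y" "infinite Y'" "homogeneous_on \<B> Y' k"
      using infinite_homogeneous_subset[OF Y(2)] .
    with Y c show ?case
      by (intro exI[of _ Y']) (auto intro: homogeneous_on_subset)
  qed
  then show ?thesis using that by blast
qed

lemma disjoint_repsD:
  assumes "A \<in> disjoint_reps h \<A> S"
  shows "A \<in> extensional {1..h}" "\<And>i. i \<in> {1..h} \<Longrightarrow> A i \<in> \<A> i"
    "disjoint_family_on A {1..h}" "(\<Union>i\<in>{1..h}. A i) = S" "\<And>i. i \<in> {1..h} \<Longrightarrow> A i \<subseteq> S"
  using assms unfolding disjoint_reps_def by (auto simp: PiE_iff)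

text \<open>Transposing two elements of \<open>S\<close> preserves the size of every part, so
  homogeneity keeps each part in its family.\<close>

lemma card_le_Suc_rep_count:
  assumes fin: "finite (disjoint_reps h \<A> S)"
    and A: "A \<in> disjoint_reps h \<A> S"
    and S: "finite S" "S \<subseteq> Y"
    and hom: "\<And>i. i \<in> {1..h} \<Longrightarrow> homogeneous_on (\<A> i) Y (card (A i))"
    and p: "p \<in> {1..h}" "A p \<noteq> {}" "A p \<noteq> S"
  shows "card S \<le> Suc (rep_count h \<A> S)"
proof -
  note AD = disjoint_repsD[OF A]
  \<comment> \<open>The element \<open>y\<close> lies in some other part, which has to receive
    \<open>x\<close> in exchange; hence one transposition acts on all parts. The restricted
    abstraction makes the result extensional.\<close>
  define swap where "swap = (\<lambda>(x, y). \<lambda>i\<in>{1..h}. transpose x y ` A i)"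
  have swap_p: "swap (x, y) p = insert y (A p - {x})" if "x \<in> A p" "y \<in> S - A p" for x y
    using that p(1) unfolding swap_def by (auto simp: transpose_def image_iff)
  have "inj_on swap (A p \<times> (S - A p))"
  proof (rule inj_onI, clarify)
    fix x y x' y'
    assume xy: "x \<in> A p" "y \<in> S" "y \<notin> A p" "x' \<in> A p" "y' \<in> S" "y' \<notin> A p"
      and "swap (x, y) = swap (x', y')"
    then have eq: "insert y (A p - {x}) = insert y' (A p - {x'})"
      using swap_p[of x y] swap_p[of x' y'] by simp
    \<comment> \<open>The new part at \<open>p\<close> contains only \<open>y\<close> from outside
      \<open>A p\<close> and lacks only \<open>x\<close> from \<open>A p\<close>, so it determines
      the pair.\<close>
    then have "y \<in> insert y' (A p - {x'})" by blast
    moreover have "x' \<notin> insert y (A p - {x})" using eq xy by auto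
    ultimately show "x = x' \<and> y = y'" using xy by blast
  qed
  moreover have "swap ` (A p \<times> (S - A p)) \<subseteq> disjoint_reps h \<A> S"
  proof clarify
    fix x y assume xy: "x \<in> A p" "y \<in> S" "y \<notin> A p"
    have x: "x \<in> S" using xy(1) AD(5)[OF p(1)] by blast
    have S_eq: "transpose x y ` S = S"
      using x xy(2) by (auto simp: transpose_def image_iff)
    have mem: "transpose x y ` A i \<in> \<A> i" if i: "i \<in> {1..h}" for i
    proof (rule homogeneous_onD[OF hom[OF i] _ AD(2)[OF i]])
      have "A i \<subseteq> S" using AD(5)[OF i] .
      moreover from this have "transpose x y ` A i \<subseteq> S" using S_eq by blast
      ultimately show "A i \<in> [Y]\<^bsup>card (A i)\<^esup>" "transpose x y ` A i \<in> [Y]\<^bsup>card (A i)\<^esup>"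
        using S by (auto simp: nsets_def card_image intro: finite_subset)
    qed
    have "disjoint_family_on (swap (x, y)) {1..h}"
      using AD(3) unfolding disjoint_family_on_def swap_def
      by (simp add: image_Int[symmetric])
    moreover have "S = (\<Union>i\<in>{1..h}. swap (x, y) i)"
      using S_eq AD(4) unfolding swap_def by (simp add: image_UN[symmetric])
    ultimately show "swap (x, y) \<in> disjoint_reps h \<A> S"
      using mem unfolding disjoint_reps_def by (auto simp: swap_def)
  qed
  ultimately have "card (A p \<times> (S - A p)) \<le> rep_count h \<A> S"
    unfolding rep_count_def using fin by (rule card_inj_on_le)
  then have le: "card (A p) * card (S - A p) \<le> rep_count h \<A> S"
    by (simp add: card_cartesian_product)
  have sub: "A p \<subseteq> S" using AD(5)[OF p(1)] .
  then have fin_p: "finite (A p)" using S(1) by (rule finite_subset)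
  have "card (A p) > 0" "card (S - A p) > 0"
    using fin_p S(1) sub p by (auto simp: card_gt_0_iff)
  \<comment> \<open>This is (a - 1)(b - 1) \<ge> 0 for positive integers a and b.\<close>
  then have "card (A p) + card (S - A p) \<le> Suc (card (A p) * card (S - A p))"
    by (cases "card (A p)"; cases "card (S - A p)") auto
  moreover have "card S = card (A p) + card (S - A p)"
    using S(1) sub fin_p by (simp add: card_Diff_subset card_mono)
  ultimately show ?thesis using le by linarith
qed

text \<open>By disjointness exactly one slot holds \<open>S\<close>, and that slot determines the
  representation; so two distinct representations fill different slots.\<close>

lemma trivial_reps_pair:
  assumes "rep_count h \<A> S \<ge> 2" "S \<noteq> {}"
    and triv: "\<And>A i. A \<in> disjoint_reps h \<A> S \<Longrightarrow> i \<in> {1..h} \<Longrightarrow> A i = {} \<or> A i = S"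
  obtains i j where "i \<in> {1..h}" "j \<in> {1..h}" "i \<noteq> j" "S \<in> \<A> i" "S \<in> \<A> j"
    "\<And>l. l \<in> {1..h} \<Longrightarrow> {} \<in> \<A> l"
proof -
  have full: "\<exists>i\<in>{1..h}. A i = S \<and> (\<forall>l\<in>{1..h}. l \<noteq> i \<longrightarrow> A l = {})"
    if A: "A \<in> disjoint_reps h \<A> S" for A
  proof -
    note AD = disjoint_repsD[OF A]
    obtain i where i: "i \<in> {1..h}" "A i \<noteq> {}" using AD(4) assms(2) by blast
    then have "A i = S" using triv[OF A] by blast
    moreover have "A l = {}" if "l \<in> {1..h}" "l \<noteq> i" for l
      using AD(3) AD(5)[of l] that i(1) \<open>A i = S\<close> unfolding disjoint_family_on_def by blast
    ultimately show ?thesis using i(1) by blast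
  qed
  have "\<not> card (disjoint_reps h \<A> S) \<le> Suc 0"
    using assms(1) unfolding rep_count_def by simp
  \<comment> \<open>A count of at least 2 rules out the default value 0 of \<open>card\<close> on
    infinite sets.\<close>
  moreover have "finite (disjoint_reps h \<A> S)"
    using assms(1) unfolding rep_count_def by (metis card.infinite not_numeral_le_zero)
  ultimately obtain A B where A: "A \<in> disjoint_reps h \<A> S" and B: "B \<in> disjoint_reps h \<A> S"
    and "A \<noteq> B"
    by (auto simp: card_le_Suc0_iff_eq)
  note AD = disjoint_repsD[OF A] and BD = disjoint_repsD[OF B]
  obtain i where i: "i \<in> {1..h}" "A i = S" "\<forall>l\<in>{1..h}. l \<noteq> i \<longrightarrow> A l = {}"
    using full[OF A] by blast
  obtain j where j: "j \<in> {1..h}" "B j = S" "\<forall>l\<in>{1..h}. l \<noteq> j \<longrightarrow> B l = {}"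
    using full[OF B] by blast
  have "i \<noteq> j"
  proof
    assume "i = j"
    then have "A = B"
      using i j by (intro extensionalityI[OF AD(1) BD(1)]) metis
    with \<open>A \<noteq> B\<close> show False ..
  qed
  \<comment> \<open>Slot \<open>l\<close> is empty in \<open>A\<close> unless \<open>l = i\<close>,
    and slot \<open>i\<close> is empty in \<open>B\<close>.\<close>
  moreover have "{} \<in> \<A> l" if "l \<in> {1..h}" for l
    using AD(2)[OF that] BD(2)[OF that] i(3) j(3) that \<open>i \<noteq> j\<close> by (cases "l = i") auto
  ultimately show ?thesis
    using that[of i j] AD(2)[OF i(1)] BD(2)[OF j(1)] i j by auto
qed

lemma two_part_rep:
  assumes "i \<in> {1..h}" "j \<in> {1..h}" "i \<noteq> j" "S \<in> \<A> i" "T \<in> \<A> j" "S \<inter> T = {}"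
    and "\<And>l. l \<in> {1..h} \<Longrightarrow> {} \<in> \<A> l"
  shows "(\<lambda>l\<in>{1..h}. if l = i then S else if l = j then T else {}) \<in> disjoint_reps h \<A> (S \<union> T)"
  using assms unfolding disjoint_reps_def disjoint_family_on_def
  by (auto split: if_splits)

theorem theorem8:
  fixes h :: nat and X :: "'a set" and \<A> :: "nat \<Rightarrow> 'a set set" and W :: "nat set"
  assumes "h \<ge> 2"
    and "countable X" and "infinite X"
    and "\<And>i. i \<in> {1..h} \<Longrightarrow> \<A> i \<subseteq> Fpow X"
    and "infinite W" and "\<And>n. n \<in> W \<Longrightarrow> n > 0"
    and "\<And>n. n \<in> W \<Longrightarrow> finite {S \<in> [X]\<^bsup>n\<^esup>. \<not> rep_count h \<A> S \<ge> 2}"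
  shows "\<forall>n::int. \<exists>S. S \<subseteq> X \<and> finite S \<and> int (rep_count h \<A> S) \<ge> n"
proof (rule ccontr)
  assume "\<not> ?thesis"
  then obtain N :: int where N: "\<And>S. S \<subseteq> X \<Longrightarrow> finite S \<Longrightarrow> int (rep_count h \<A> S) < N"
    by (auto simp: not_le)
  \<comment> \<open>So large that a set of at least \<open>n\<close> elements whose count is below
    \<open>N\<close> violates the bound of \<open>card_le_Suc_rep_count\<close>.\<close>
  obtain n where n: "n \<in> W" "n > nat N + 1"
    using \<open>infinite W\<close> unfolding infinite_nat_iff_unbounded by blast
  obtain m where m: "m \<in> W" "m > n"
    using \<open>infinite W\<close> unfolding infinite_nat_iff_unbounded by blast
  define bad where "bad k = {S \<in> [X]\<^bsup>k\<^esup>. \<not> rep_count h \<A> S \<ge> 2}" for k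
  have "finite (\<Union>(bad n \<union> bad m))"
    using assms(7)[OF n(1)] assms(7)[OF m(1)] unfolding bad_def by (auto simp: nsets_def)
  then have inf: "infinite (X - \<Union>(bad n \<union> bad m))"
    using \<open>infinite X\<close> by (rule Diff_infinite_finite)
  have "finite (\<A> ` {1..h} \<times> {..m})"
    by simp
  from this inf obtain Y where Y: "Y \<subseteq> X - \<Union>(bad n \<union> bad m)" "infinite Y"
    and hom': "\<And>\<B> k. (\<B>, k) \<in> \<A> ` {1..h} \<times> {..m} \<Longrightarrow> homogeneous_on \<B> Y k"
    by (rule infinite_simultaneously_homogeneous_subset) (rule that)
  from Y(1) have "Y \<subseteq> X" by blast
  have hom: "homogeneous_on (\<A> i) Y k" if "i \<in> {1..h}" "k \<le> m" for i k
    by (rule hom') (use that in simp)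
  \<comment> \<open>The bound \<open>m\<close> concerns the parts and not \<open>S\<close>, so that
    the final set of size \<open>n + m\<close> is covered too.\<close>
  have small: "A i = {} \<or> A i = S"
    if "A \<in> disjoint_reps h \<A> S" "i \<in> {1..h}" "S \<subseteq> Y" "finite S" "card S \<ge> n"
      "\<And>l. l \<in> {1..h} \<Longrightarrow> card (A l) \<le> m" for A i S
  proof (rule ccontr)
    assume "\<not> ?thesis"
    then have "card S \<le> Suc (rep_count h \<A> S)"
      using that hom finite_disjoint_reps[of h \<A> X, OF assms(4)]
      by (intro card_le_Suc_rep_count[where Y = Y and A = A and p = i]) auto
    moreover have "int (rep_count h \<A> S) < N"
      using N that \<open>Y \<subseteq> X\<close> by auto
    ultimately show False using n(2) \<open>card S \<ge> n\<close> by linarith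
  qed
  have pair: "\<exists>i\<in>{1..h}. \<exists>j\<in>{1..h}. i \<noteq> j \<and> S \<in> \<A> i \<and> S \<in> \<A> j \<and> (\<forall>l\<in>{1..h}. {} \<in> \<A> l)"
    if "S \<subseteq> Y" "finite S" "card S = k" "k \<in> {n, m}" for S k
  proof -
    \<comment> \<open>A bad set lies inside the deleted union, which is disjoint from
      \<open>Y\<close>; only the empty set could be both bad and contained in
      \<open>Y\<close>.\<close>
    have "S \<noteq> {}" using that n m by auto
    with that Y(1) have "S \<notin> bad k" by blast
    then have "rep_count h \<A> S \<ge> 2"
      using that \<open>Y \<subseteq> X\<close> unfolding bad_def nsets_def by auto
    moreover note \<open>S \<noteq> {}\<close>
    moreover have "A i = {} \<or> A i = S" if A: "A \<in> disjoint_reps h \<A> S" and "i \<in> {1..h}" for A i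
    proof (rule small[OF that \<open>S \<subseteq> Y\<close> \<open>finite S\<close>])
      show "n \<le> card S" using \<open>card S = k\<close> \<open>k \<in> {n, m}\<close> m by auto
      show "card (A l) \<le> m" if "l \<in> {1..h}" for l
        using card_mono[OF \<open>finite S\<close> disjoint_repsD(5)[OF A that]] \<open>card S = k\<close> \<open>k \<in> {n, m}\<close> m
        by auto
    qed
    ultimately obtain i j where "i \<in> {1..h}" "j \<in> {1..h}" "i \<noteq> j" "S \<in> \<A> i" "S \<in> \<A> j"
      "\<And>l. l \<in> {1..h} \<Longrightarrow> {} \<in> \<A> l"
      by (rule trivial_reps_pair) (assumption+, rule that)
    then show ?thesis by blast
  qed
  obtain S where S: "S \<subseteq> Y" "finite S" "card S = n"
    using infinite_arbitrarily_large[OF Y(2)] by metis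
  have "infinite (Y - S)" using Y(2) S(2) by simp
  then obtain T where T: "T \<subseteq> Y - S" "finite T" "card T = m"
    using infinite_arbitrarily_large by metis
  obtain j where j: "j \<in> {1..h}" "T \<in> \<A> j" and empty: "\<And>l. l \<in> {1..h} \<Longrightarrow> {} \<in> \<A> l"
    using pair[of T m] T by blast
  \<comment> \<open>Of the two families that contain \<open>S\<close>, at least one has an index
    other than \<open>j\<close>.\<close>
  obtain i where i: "i \<in> {1..h}" "S \<in> \<A> i" "i \<noteq> j"
    using pair[OF S] by blast
  define A where "A = (\<lambda>l\<in>{1..h}. if l = i then S else if l = j then T else {})"
  have "A \<in> disjoint_reps h \<A> (S \<union> T)"
    unfolding A_def using i j empty T(1) by (intro two_part_rep) auto
  then have "A i = {} \<or> A i = S \<union> T"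
  proof (rule small[OF _ i(1)])
    show "S \<union> T \<subseteq> Y" "finite (S \<union> T)" using S T by auto
    have "card S \<le> card (S \<union> T)" using S(2) T(2) by (intro card_mono) auto
    then show "n \<le> card (S \<union> T)" using S(3) by simp
    show "card (A l) \<le> m" if "l \<in> {1..h}" for l
      using that S(3) T(3) m(2) by (simp add: A_def)
  qed
  moreover have "A i = S" using i(1) by (simp add: A_def)
  moreover have "S \<noteq> {}" "T \<noteq> {}" using S(3) T(3) n(2) m(2) by auto
  ultimately show False using T(1) by blast
qed

end
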